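(* Let $f\in\mathcal{S}_\theta(m,L)$ and consider a $p$-step first-order algorithm ($p\ge1$) with matrices $A(\theta),B(\theta),C(\theta),D(\theta),C_x$ of the lifted form given in the context, run along a parameter sequence $\{\theta_k\}_{k\ge0}\subset\Theta$ that satisfies the rate bound $\underline\nu\le\theta_{k+1}-\theta_k\le\overline\nu$ (componentwise) for all $k$. Assume there is a matrix $U\in\mathbb{R}^{n_\xi\times d}$ such that for all $\theta\in\Theta$ $$(I-A(\theta))U=0,\qquad C(\theta)U=1_p\otimes I_d,\qquad C_xU=I_d,$$ and set $\xi_k^\star=Ux_k^\star$, $\Delta\xi_k^\star=\xi_k^\star-\xi_{k+1}^\star$. Define $$D_\Psi^y(\theta)=I_p\otimes\begin{bmatrix} L(\theta)I_d \\ -m(\theta)I_d \end{bmatrix},\quad D_\Psi^u(\theta)=I_p\otimes\begin{bmatrix} -I_d \\ I_d \end{bmatrix},\quad \hat C=D_\Psi^yC,\quad \hat D=D_\Psi^yD+D_\Psi^u,\quad M=\begin{bmatrix} 0 & I_d \\ I_d & 0 \end{bmatrix}.$$ Suppose there exist a continuous symmetric-matrix-valued function $P:\Theta\to\mathbb{S}^{n_\xi}$ with $P(\theta)\succ0$ for all $\theta\in\Theta$, a continuous function $\lambda_p:\Theta\to\mathbb{R}^p_{\ge0}$, and $\rho\in(0,1)$ such that, with $M_\lambda(\theta)=\mathrm{diag}(\lambda_p(\theta))\otimes M$, $$\begin{bmatrix} I & 0 \\ A(\theta) & B(\theta) \\ \hat C(\theta) & \hat D(\theta) \end{bmatrix}^\top\begin{bmatrix}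 -\rho^2P(\theta) & & \\ & P(\theta+\Delta\theta) & \\ & & M_\lambda(\theta) \end{bmatrix}\begin{bmatrix} I & 0 \\ A(\theta) & B(\theta) \\ \hat C(\theta) & \hat D(\theta) \end{bmatrix}\preceq0\qquad\text{for all }(\theta,\Delta\theta)\in\mathcal{V}_{\Theta,\nu}.$$ Then for any $\xi_0$ and all $k\ge0$, $$\|\xi_k-\xi_k^\star\|\le c\,\rho^k\|\xi_0-\xi_0^\star\|+c\sum_{t=1}^k\rho^{k-t}\|\Delta\xi^\star_{t-1}\|,$$ where $c=\sqrt{\overline\lambda/\underline\lambda}$, $\overline\lambda=\max_{\theta\in\Theta}\lambda_{\max}(P(\theta))$, $\underline\lambda=\min_{\theta\in\Theta}\lambda_{\min}(P(\theta))$.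
   Context: $\Theta\subset\mathbb{R}^{n_\theta}$ is compact. $f\in\mathcal{S}_\theta(m,L)$ means $f:\mathbb{R}^d\times\Theta\to\mathbb{R}$ and: $m,L:\Theta\to\mathbb{R}$ are continuous with $0<\underline m<m(\theta)<L(\theta)<\overline L<\infty$ for all $\theta\in\Theta$ and some scalars $\underline m,\overline L$; $f(\cdot,\theta)$ is $m(\theta)$-strongly convex and $L(\theta)$-smooth (Lipschitz gradient) in $x$; $\nabla_xf(x,\theta)$ is continuous in $\theta$ for every $x$. Notation: $\nabla f_k(\cdot)=\nabla_xf(\cdot,\theta_k)$, $x_k^\star=\arg\min_{x\in\mathbb{R}^d}f(x,\theta_k)$. $\|\cdot\|$ is the Euclidean norm, $\mathbb{S}^n$ the real symmetric $n\times n$ matrices, $1_p$ the all-ones column vector of length $p$, $\otimes$ the Kronecker product. The set of admissible parameter-variation pairs is $\mathcal{V}_{\Theta,\nu}=\{(\theta,\Delta\theta):\theta\in\Theta,\ \theta+\Delta\theta\in\Theta,\ \underline\nu\le\Delta\theta\le\overline\nu\}$, with $\underline\nu,\overline\nu\in\mathbb{R}^{n_\theta}$ given and inequalities componentwise. Algorithm: let $\bar A(\theta)\in\mathbb{R}^{n_\xi\times n_\xi}$, $\bar B(\theta)\in\mathbb{R}^{n_\xi\times d}$, $\bar C(\theta)\in\mathbb{R}^{d\times n_\xi}$ be continuous in $\theta\in\Theta$ (the one-step algorithm $\hat\xi^+=\bar A\hat\xi+\bar B\nabla f_k(\hat y)$, $\hat y=\bar C\hat\xi$). The corresponding $p$-step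 algorithm is $$\xi_{k+1}=A(\theta_k)\xi_k+B(\theta_k)u_k,\qquad y_k=C(\theta_k)\xi_k+D(\theta_k)u_k,\qquad u_k=(\nabla f_k(y_k^1),\dots,\nabla f_k(y_k^p)),$$ with $y_k=(y_k^1,\dots,y_k^p)\in(\mathbb{R}^d)^p$, $A=\bar A^p$, $B=[\bar A^{p-1}\bar B\ \cdots\ \bar A\bar B\ \bar B]$, $C$ having block rows $\bar C\bar A^{i-1}$, $i=1,\dots,p$, and $D$ having $d\times d$ blocks $D_{ij}=\bar C\bar A^{i-1-j}\bar B$ for $j<i$ and $D_{ij}=0$ for $j\ge i$ (strictly lower block triangular, so $y_k$ is well defined). The algorithm's decision is $x_k=C_x\xi_k$ with a constant matrix $C_x\in\mathbb{R}^{d\times n_\xi}$. *)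

theory Defs
  imports "HOL-Analysis.Analysis"
begin

subsection \<open>The function class\<close>

text \<open>Meaningful only where \<open>g\<close> is differentiable; \<open>smooth_with\<close> demands this everywhere.\<close>

definition gradient :: "(real^'d \<Rightarrow> real) \<Rightarrow> real^'d \<Rightarrow> real^'d"
  where "gradient g x = (THE D. GDERIV g x :> D)"

definition strongly_convex :: "real \<Rightarrow> (real^'d \<Rightarrow> real) \<Rightarrow> bool"
  where "strongly_convex \<mu> g \<longleftrightarrow>
    (\<forall>x y. \<forall>t\<in>{0..1}. g ((1 - t) *\<^sub>R x + t *\<^sub>R y)
        \<le> (1 - t) * g x + t * g y - \<mu> / 2 * t * (1 - t) * (norm (x - y))\<^sup>2)"

definition smooth_with :: "real \<Rightarrow> (real^'d \<Rightarrow> real) \<Rightarrow> bool"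
  where "smooth_with L g \<longleftrightarrow>
    (\<forall>x. g differentiable (at x)) \<and> L-lipschitz_on UNIV (gradient g)"

definition class_S :: "(real^'t) set \<Rightarrow> (real^'t \<Rightarrow> real) \<Rightarrow> (real^'t \<Rightarrow> real)
    \<Rightarrow> (real^'d \<Rightarrow> real^'t \<Rightarrow> real) \<Rightarrow> bool"
  where "class_S \<Theta> m L f \<longleftrightarrow>
    continuous_on \<Theta> m \<and> continuous_on \<Theta> L \<and>
    (\<exists>m_low L_up. 0 < m_low \<and> (\<forall>\<theta>\<in>\<Theta>. m_low < m \<theta> \<and> m \<theta> < L \<theta> \<and> L \<theta> < L_up)) \<and>
    (\<forall>\<theta>\<in>\<Theta>. strongly_convex (m \<theta>) (\<lambda>x. f x \<theta>) \<and> smooth_with (L \<theta>) (\<lambda>x. f x \<theta>)) \<and>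
    (\<forall>x. continuous_on \<Theta> (\<lambda>\<theta>. gradient (\<lambda>z. f z \<theta>) x))"

text \<open>The order on vectors is the componentwise one.\<close>

definition admissible_variations ::
    "(real^'t) set \<Rightarrow> real^'t \<Rightarrow> real^'t \<Rightarrow> ((real^'t) \<times> (real^'t)) set"
  where "admissible_variations \<Theta> \<nu>_low \<nu>_up =
    {(\<theta>, \<Delta>\<theta>). \<theta> \<in> \<Theta> \<and> \<theta> + \<Delta>\<theta> \<in> \<Theta> \<and> \<nu>_low \<le> \<Delta>\<theta> \<and> \<Delta>\<theta> \<le> \<nu>_up}"

subsection \<open>Matrices\<close>

text \<open>The product \<open>*\<close> (and hence \<open>^\<close>) on \<open>real^'n^'n\<close> is componentwise, so the matrix power
  needs its own definition.\<close>

definition mat_pow :: "real^'n^'n \<Rightarrow> nat \<Rightarrow> real^'n^'n"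
  where "mat_pow X k = (((**) X) ^^ k) (mat 1)"

text \<open>Block matrices are indexed by sum types: \<open>Inl\<close> is the first block, \<open>Inr\<close> the second.
  \<open>hcat X Y\<close> is the row \<open>[X Y]\<close>, \<open>vcat X Y\<close> the column \<open>[X; Y]\<close>.\<close>

definition hcat :: "real^'b^'a \<Rightarrow> real^'c^'a \<Rightarrow> real^('b + 'c)^'a"
  where "hcat X Y = (\<chi> i j. case j of Inl b \<Rightarrow> X $ i $ b | Inr c \<Rightarrow> Y $ i $ c)"

definition vcat :: "real^'c^'a \<Rightarrow> real^'c^'b \<Rightarrow> real^'c^('a + 'b)"
  where "vcat X Y = (\<chi> i. case i of Inl a \<Rightarrow> X $ a | Inr b \<Rightarrow> Y $ b)"

definition block_diag :: "real^'b^'a \<Rightarrow> real^'d^'c \<Rightarrow> real^('b + 'd)^('a + 'c)"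
  where "block_diag X Y = vcat (hcat X 0) (hcat 0 Y)"

text \<open>Kronecker products are indexed by pairs, the first component being the block index.
  \<open>kron_col\<close> is the case of a column vector as left factor; it avoids the index type \<open>1 \<times> 'b\<close>.\<close>

definition kron :: "real^'b^'a \<Rightarrow> real^'d^'c \<Rightarrow> real^('b \<times> 'd)^('a \<times> 'c)"
  where "kron X Y = (\<chi> r s. X $ fst r $ fst s * Y $ snd r $ snd s)"

definition kron_col :: "real^'a \<Rightarrow> real^'b^'c \<Rightarrow> real^'b^('a \<times> 'c)"
  where "kron_col v Y = (\<chi> r s. v $ fst r * Y $ snd r $ s)"

definition diag_mat :: "real^'n \<Rightarrow> real^'n^'n"
  where "diag_mat v = (\<chi> i j. if i = j then v $ i else 0)"

definition pos_def :: "real^'n^'n \<Rightarrow> bool"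
  where "pos_def X \<longleftrightarrow> transpose X = X \<and> (\<forall>v. v \<noteq> 0 \<longrightarrow> 0 < v \<bullet> (X *v v))"

definition neg_semidef :: "real^'n^'n \<Rightarrow> bool"
  where "neg_semidef X \<longleftrightarrow> transpose X = X \<and> (\<forall>v. v \<bullet> (X *v v) \<le> 0)"

text \<open>Used for symmetric matrices only, whose real spectrum is finite and nonempty.
  The maximum of \<open>lambda_max\<close> and minimum of \<open>lambda_min\<close> over the infinite compact parameter set are
  written \<open>SUP\<close> and \<open>INF\<close>, since \<open>Max\<close> and \<open>Min\<close> are for finite sets only.\<close>

definition eigenvalues :: "real^'n^'n \<Rightarrow> real set"
  where "eigenvalues X = {l. \<exists>v. v \<noteq> 0 \<and> X *v v = l *\<^sub>R v}"

definition lambda_max :: "real^'n^'n \<Rightarrow> real"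
  where "lambda_max X = Max (eigenvalues X)"

definition lambda_min :: "real^'n^'n \<Rightarrow> real"
  where "lambda_min X = Min (eigenvalues X)"

subsection \<open>The p-step algorithm\<close>

text \<open>The steps \<open>1, \<dots>, p\<close> are the elements of a finite linearly ordered type \<open>'p\<close> with
  \<open>p = CARD('p)\<close>; \<open>(\<real>\<^sup>d)\<^sup>p\<close> is \<open>real^('p \<times> 'd)\<close>. The position \<open>pos i\<close> counts from 0, so it is
  \<open>i - 1\<close> for the \<open>i\<close>-th step.\<close>

definition pos :: "'p::{finite,linorder} \<Rightarrow> nat"
  where "pos i = card {j. j < i}"

definition block :: "real^('p::finite \<times> 'd) \<Rightarrow> 'p \<Rightarrow> real^'d"
  where "block v i = (\<chi> j. v $ (i, j))"

definition stack :: "('p::finite \<Rightarrow> real^'d) \<Rightarrow> real^('p \<times> 'd)"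
  where "stack w = (\<chi> r. w (fst r) $ snd r)"

definition lift_B :: "real^'n^'n \<Rightarrow> real^'d^'n \<Rightarrow> real^('p::{finite,linorder} \<times> 'd)^'n"
  where "lift_B Ab Bb =
    (\<chi> r s. (mat_pow Ab (CARD('p) - 1 - pos (fst s)) ** Bb) $ r $ snd s)"

definition lift_C :: "real^'n^'n \<Rightarrow> real^'n^'d \<Rightarrow> real^'n^('p::{finite,linorder} \<times> 'd)"
  where "lift_C Ab Cb = (\<chi> r s. (Cb ** mat_pow Ab (pos (fst r))) $ snd r $ s)"

definition lift_D :: "real^'n^'n \<Rightarrow> real^'d^'n \<Rightarrow> real^'n^'d
    \<Rightarrow> real^('p::{finite,linorder} \<times> 'd)^('p \<times> 'd)"
  where "lift_D Ab Bb Cb =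
    (\<chi> r s. if fst s < fst r
      then (Cb ** mat_pow Ab (pos (fst r) - 1 - pos (fst s)) ** Bb) $ snd r $ snd s
      else 0)"

end

theory Submission
  imports Defs
begin

text \<open>
  For a fixed parameter the error \<open>e = \<xi> - U *v x\<close>, with \<open>x\<close> the minimizer, obeys the same
  linear recursion as the algorithm itself: \<open>A U = U\<close> makes \<open>U *v x\<close> a fixed point of the state
  update, \<open>C U = 1 \<otimes> I\<close> shifts every gradient evaluation point by \<open>x\<close>, and the gradient vanishes
  at \<open>x\<close>. Evaluated at the stacked vector \<open>(e, u)\<close>, the matrix inequality says

    \<open>V\<^sub>+(e\<^sub>+)\<^sup>2 - \<rho>\<^sup>2 V(e)\<^sup>2 + (multiplier term) \<le> 0\<close>,

  where \<open>V\<close> and \<open>V\<^sub>+\<close> are the norms given by \<open>P\<close> at the current and at the next parameter, and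
  \<open>e\<^sub>+\<close> is the next state measured against the current minimizer. The multiplier term is a
  nonnegative combination of the expressions
  \<open>(L dy - du) \<bullet> (du - m dy)\<close>, one for each gradient evaluation, where \<open>dy\<close> and \<open>du\<close> are the
  deviations of the point and of the gradient from their values at \<open>x\<close>. These are nonnegative because
  the gradient of an \<open>m\<close>-strongly convex, \<open>L\<close>-smooth function lies in the sector \<open>[m, L]\<close>
  (\<open>gradient_sector\<close>). Hence one step contracts the error by \<open>\<rho>\<close>, up to the change of norm, which
  the matrix inequality already accounts for.

  Moving the reference from the current minimizer to the next one costs at most
  \<open>V\<^sub>+(\<Delta>\<xi>\<^sup>\<star>)\<close> by the triangle inequality. Unrolling the resulting scalar recursion gives the claimed
  bound in the norms \<open>V\<close>. These norms are uniformly equivalent to the Euclidean norm with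
  constants \<open>sqrt lam_low\<close> and \<open>sqrt lam_up\<close> (\<open>uniform_quadratic_form_bounds\<close>); comparing only at
  the two ends of the recursion, rather than at each step, is what makes the factor \<open>c\<close> appear
  once instead of \<open>k\<close> times.
\<close>

section \<open>The sector inequality for gradients\<close>

lemma gradient_works:
  fixes g :: "real^'d \<Rightarrow> real"
  assumes "g differentiable (at x)"
  shows "GDERIV g x :> gradient g x"
proof -
  obtain g' where g': "(g has_derivative g') (at x)"
    using assms by (auto simp: differentiable_def)
  then have lin: "linear g'"
    by (simp add: bounded_linear.linear has_derivative_bounded_linear)
  have ex: "GDERIV g x :> adjoint g' 1"
    using g' adjoint_works[OF lin, of _ 1] by (simp add: gderiv_def)
  show ?thesis
    unfolding gradient_def
  proof (rule theI[where P = "\<lambda>D. GDERIV g x :> D", OF ex])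
    fix D assume "GDERIV g x :> D"
    then have "(\<lambda>h. h \<bullet> D) = (\<lambda>h. h \<bullet> adjoint g' 1)"
      using ex has_derivative_unique unfolding gderiv_def by blast
    then show "D = adjoint g' 1"
      by (metis vector_eq_ldot)
  qed
qed

lemma DERIV_along_line:
  fixes g :: "real^'d \<Rightarrow> real"
  assumes "g differentiable (at (x + t *\<^sub>R d))"
  shows "((\<lambda>s. g (x + s *\<^sub>R d)) has_real_derivative (d \<bullet> gradient g (x + t *\<^sub>R d))) (at t)"
proof -
  have 1: "((\<lambda>s. x + s *\<^sub>R d) has_derivative (\<lambda>s. s *\<^sub>R d)) (at t)"
    by (auto intro!: derivative_eq_intros)
  have "(g has_derivative (\<lambda>h. h \<bullet> gradient g (x + t *\<^sub>R d))) (at (x + t *\<^sub>R d))"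
    using gradient_works[OF assms] by (simp add: gderiv_def)
  from has_derivative_compose[OF 1 this] show ?thesis
    by (simp add: has_field_derivative_def mult.commute[of _ "d \<bullet> _"])
qed

text \<open>Divide the convexity inequality on the segment from \<open>x\<close> to \<open>y\<close> by the segment parameter
  \<open>t\<close> and let \<open>t\<close> tend to 0 from the right: the difference quotient becomes a directional
  derivative.\<close>

lemma strongly_convex_lower_bound:
  fixes g :: "real^'d \<Rightarrow> real"
  assumes sc: "strongly_convex \<mu> g" and diff: "g differentiable (at x)"
  shows "g x + (y - x) \<bullet> gradient g x + \<mu> / 2 * (norm (y - x))\<^sup>2 \<le> g y"
proof -
  define d where "d = y - x"
  have lim: "((\<lambda>t. (g (x + t *\<^sub>R d) - g x) / t) \<longlongrightarrow> d \<bullet> gradient g x) (at_right 0)"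
    using DERIV_along_line[of g x 0 d] diff
    by (auto simp: has_field_derivative_iff intro: tendsto_mono[OF at_le])
  have lim': "((\<lambda>t. g y - g x - \<mu> / 2 * (1 - t) * (norm d)\<^sup>2)
      \<longlongrightarrow> g y - g x - \<mu> / 2 * (1 - 0) * (norm d)\<^sup>2) (at_right 0)"
    by (intro tendsto_intros)
  have "\<forall>\<^sub>F t in at_right (0::real). t \<in> {0<..<1}"
    by (rule eventually_at_right_real) simp
  then have "\<forall>\<^sub>F t in at_right 0.
      (g (x + t *\<^sub>R d) - g x) / t \<le> g y - g x - \<mu> / 2 * (1 - t) * (norm d)\<^sup>2"
  proof eventually_elim
    case (elim t)
    have "x + t *\<^sub>R d = (1 - t) *\<^sub>R x + t *\<^sub>R y"
      by (simp add: d_def algebra_simps)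
    then have "g (x + t *\<^sub>R d)
        \<le> (1 - t) * g x + t * g y - \<mu> / 2 * t * (1 - t) * (norm d)\<^sup>2"
      using sc elim by (auto simp: strongly_convex_def d_def norm_minus_commute)
    then have "g (x + t *\<^sub>R d) - g x
        \<le> (g y - g x - \<mu> / 2 * (1 - t) * (norm d)\<^sup>2) * t"
      by (simp add: algebra_simps)
    then show ?case
      using elim by (simp add: divide_le_eq)
  qed
  from tendsto_le[OF _ lim' lim this] show ?thesis
    by (simp add: d_def)
qed

text \<open>The descent lemma: along the segment, the difference of the two sides is nonincreasing,
  since the Lipschitz bound makes its derivative nonpositive.\<close>

lemma smooth_upper_bound:
  fixes g :: "real^'d \<Rightarrow> real"
  assumes "smooth_with L g"
  shows "g y \<le> g x + (y - x) \<bullet> gradient g x + L / 2 * (norm (y - x))\<^sup>2"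
proof -
  have diff: "g differentiable (at z)" for z
    using assms by (simp add: smooth_with_def)
  have lip: "norm (gradient g z - gradient g w) \<le> L * norm (z - w)" for z w
    using assms lipschitz_onD[of L UNIV "gradient g" z w] by (simp add: smooth_with_def dist_norm)
  define d where "d = y - x"
  define \<phi> where "\<phi> t = g (x + t *\<^sub>R d) - t * (d \<bullet> gradient g x) - L / 2 * t\<^sup>2 * (norm d)\<^sup>2" for t
  have "\<phi> 1 \<le> \<phi> 0"
  proof (rule DERIV_nonpos_imp_nonincreasing[where f = \<phi> and a = 0 and b = 1])
    fix t :: real assume t: "0 \<le> t"
    let ?D = "d \<bullet> gradient g (x + t *\<^sub>R d) - d \<bullet> gradient g x - L * t * (norm d)\<^sup>2"
    have "(\<phi> has_real_derivative ?D) (at t)"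
      unfolding \<phi>_def by (auto intro!: derivative_eq_intros DERIV_along_line diff)
    moreover have "d \<bullet> (gradient g (x + t *\<^sub>R d) - gradient g x)
        \<le> norm d * norm (gradient g (x + t *\<^sub>R d) - gradient g x)"
      by (rule norm_cauchy_schwarz)
    moreover have "norm d * norm (gradient g (x + t *\<^sub>R d) - gradient g x) \<le> norm d * (L * (t * norm d))"
      using lip[of "x + t *\<^sub>R d" x] t by (intro mult_left_mono) auto
    ultimately show "\<exists>D. (\<phi> has_real_derivative D) (at t) \<and> D \<le> 0"
      by (intro exI[of _ ?D]) (auto simp: inner_diff_right power2_eq_square algebra_simps)
  qed simp
  then show ?thesis
    by (simp add: \<phi>_def d_def algebra_simps)
qed

text \<open>A sharpening of the strong convexity bound. The lower bound based at \<open>x\<close> and the upper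
  bound based at \<open>y\<close> hold at every common point \<open>w\<close>; chaining them gives a family of inequalities
  between \<open>g x\<close> and \<open>g y\<close>, and the strongest member is the claim. Equivalently,
  it is the bound of a convex function with \<open>(L - \<mu>)\<close>-Lipschitz gradient, applied to \<open>g\<close> minus
  its quadratic part \<open>\<mu> / 2 * (norm x)\<^sup>2\<close>.\<close>

lemma smooth_strongly_convex_interpolation:
  fixes g :: "real^'d \<Rightarrow> real"
  assumes sc: "strongly_convex \<mu> g" and sm: "smooth_with L g" and "\<mu> < L"
  shows "g x + (y - x) \<bullet> gradient g x + \<mu> / 2 * (norm (y - x))\<^sup>2
      + (norm (gradient g y - gradient g x - \<mu> *\<^sub>R (y - x)))\<^sup>2 / (2 * (L - \<mu>)) \<le> g y"
proof -
  define d z s where "d = y - x" and "z = gradient g y - gradient g x - \<mu> *\<^sub>R d"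
    and "s = 1 / (L - \<mu>)"
  \<comment> \<open>This \<open>w\<close> minimizes the upper bound minus the lower bound, a quadratic with Hessian
    \<open>(L - \<mu>) I\<close> whose gradient at \<open>y\<close> is \<open>z\<close>.\<close>
  define w where "w = y - s *\<^sub>R z"
  have "g differentiable (at x)"
    using sm by (simp add: smooth_with_def)
  then have lower: "g x + (w - x) \<bullet> gradient g x + \<mu> / 2 * (norm (w - x))\<^sup>2 \<le> g w"
    by (rule strongly_convex_lower_bound[OF sc])
  have upper: "g w \<le> g y + (w - y) \<bullet> gradient g y + L / 2 * (norm (w - y))\<^sup>2"
    by (rule smooth_upper_bound[OF sm])
  have wx: "w - x = d - s *\<^sub>R z" and wy: "w - y = - (s *\<^sub>R z)"
    by (simp_all add: w_def d_def)
  have gy: "gradient g y = z + gradient g x + \<mu> *\<^sub>R d"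
    by (simp add: z_def)
  have "g x + d \<bullet> gradient g x + \<mu> / 2 * (d \<bullet> d) + (s - (L - \<mu>) / 2 * s\<^sup>2) * (z \<bullet> z) \<le> g y"
    using order_trans[OF lower upper] unfolding wx wy power2_norm_eq_inner gy
    by (simp add: algebra_simps inner_commute power2_eq_square diff_divide_distrib)
  moreover have "s - (L - \<mu>) / 2 * s\<^sup>2 = 1 / (2 * (L - \<mu>))"
  proof -
    have "1 / \<kappa> - \<kappa> / 2 * (1 / \<kappa>)\<^sup>2 = 1 / (2 * \<kappa>)" if "0 < \<kappa>" for \<kappa> :: real
      using that by (simp add: power2_eq_square field_simps)
    from this[of "L - \<mu>"] show ?thesis
      using \<open>\<mu> < L\<close> by (simp add: s_def)
  qed
  ultimately show ?thesis
    by (simp add: z_def d_def power2_norm_eq_inner)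
qed

text \<open>Adding the interpolation inequality from \<open>x\<close> to \<open>y\<close> and the one from \<open>y\<close> to \<open>x\<close> cancels
  the function values and leaves cocoercivity of the gradient of
  \<open>g - \<mu> / 2 * (norm x)\<^sup>2\<close>, which is the sector condition in other variables.\<close>

lemma gradient_sector:
  fixes g :: "real^'d \<Rightarrow> real"
  assumes "strongly_convex \<mu> g" and "smooth_with L g" and "\<mu> < L"
  shows "0 \<le> (L *\<^sub>R (y - x) - (gradient g y - gradient g x))
      \<bullet> ((gradient g y - gradient g x) - \<mu> *\<^sub>R (y - x))"
proof -
  define d z where "d = y - x" and "z = gradient g y - gradient g x - \<mu> *\<^sub>R d"
  have gy: "gradient g y = z + gradient g x + \<mu> *\<^sub>R d"
    by (simp add: z_def)
  have 1: "g x + d \<bullet> gradient g x + \<mu> / 2 * (d \<bullet> d) + (z \<bullet> z) / (2 * (L - \<mu>)) \<le> g y"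
    using smooth_strongly_convex_interpolation[OF assms, of x y]
    by (simp add: d_def z_def power2_norm_eq_inner)
  have "(norm (gradient g x - gradient g y - \<mu> *\<^sub>R (x - y)))\<^sup>2 = z \<bullet> z"
    unfolding z_def d_def power2_norm_eq_inner by (simp add: algebra_simps inner_commute)
  moreover have "x - y = - d" by (simp add: d_def)
  ultimately have 2: "g y - d \<bullet> gradient g y + \<mu> / 2 * (d \<bullet> d) + (z \<bullet> z) / (2 * (L - \<mu>)) \<le> g x"
    using smooth_strongly_convex_interpolation[OF assms, of y x]
    by (simp add: power2_norm_eq_inner)
  have "(z \<bullet> z) / (L - \<mu>) \<le> d \<bullet> z"
  proof -
    have "q / \<kappa> = q / (2 * \<kappa>) + q / (2 * \<kappa>)" for q \<kappa> :: real
      by (cases "\<kappa> = 0") (simp_all add: field_simps)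
    then have "(z \<bullet> z) / (L - \<mu>) = (z \<bullet> z) / (2 * (L - \<mu>)) + (z \<bullet> z) / (2 * (L - \<mu>))" .
    moreover have "d \<bullet> gradient g y = d \<bullet> z + d \<bullet> gradient g x + \<mu> * (d \<bullet> d)"
      by (simp add: gy inner_add_right)
    moreover have "\<mu> * (d \<bullet> d) = 2 * (\<mu> / 2 * (d \<bullet> d))"
      by simp
    moreover define q r where "q = (z \<bullet> z) / (2 * (L - \<mu>))" and "r = \<mu> / 2 * (d \<bullet> d)"
    ultimately show ?thesis
      using 1 2 unfolding q_def[symmetric] r_def[symmetric] by linarith
  qed
  then have "z \<bullet> z \<le> (L - \<mu>) * (d \<bullet> z)"
    using \<open>\<mu> < L\<close> by (simp add: divide_le_eq mult.commute)
  moreover have "L *\<^sub>R d - (gradient g y - gradient g x) = (L - \<mu>) *\<^sub>R d - z"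
    by (simp add: z_def algebra_simps)
  ultimately show ?thesis
    unfolding z_def[symmetric] d_def[symmetric] by (simp add: inner_diff_left)
qed

text \<open>The quadratic lower bound at 0 exceeds \<open>g 0\<close> outside a ball, so a minimum over
  that compact ball is a global one.\<close>

lemma strongly_convex_attains_min:
  fixes g :: "real^'d \<Rightarrow> real"
  assumes sc: "strongly_convex \<mu> g" and diff: "\<And>x. g differentiable (at x)" and "0 < \<mu>"
  shows "\<exists>x. \<forall>y. g x \<le> g y"
proof -
  define G where "G = gradient g 0"
  \<comment> \<open>Beyond this radius the quadratic term of the lower bound dominates the linear one.\<close>
  define R where "R = 2 * norm G / \<mu>"
  have R: "0 \<le> R" using \<open>0 < \<mu>\<close> by (simp add: R_def)
  have "continuous_on (cball 0 R) g"
    using diff by (intro continuous_at_imp_continuous_on ballI differentiable_imp_continuous_within) simp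
  then obtain x where x: "x \<in> cball 0 R" and min: "\<And>y. y \<in> cball 0 R \<Longrightarrow> g x \<le> g y"
    using continuous_attains_inf[of "cball 0 R" g] R by auto
  have "g x \<le> g y" for y
  proof (cases "y \<in> cball 0 R")
    case False
    then have "R < norm y" by simp
    then have far: "norm G \<le> \<mu> / 2 * norm y"
      using \<open>0 < \<mu>\<close> by (simp add: R_def field_simps)
    have "g 0 + y \<bullet> G + \<mu> / 2 * (norm y)\<^sup>2 \<le> g y"
      using strongly_convex_lower_bound[OF sc diff, of 0 y] by (simp add: G_def)
    moreover have "- (norm y * norm G) \<le> y \<bullet> G"
      using Cauchy_Schwarz_ineq2[of y G] by linarith
    moreover have "norm y * norm G \<le> norm y * (\<mu> / 2 * norm y)"
      using far by (intro mult_left_mono) auto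
    moreover have "g x \<le> g 0"
      using min R by simp
    ultimately show ?thesis
      by (simp add: power2_eq_square algebra_simps)
  qed (rule min)
  then show ?thesis by blast
qed

lemma gradient_zero_at_min:
  fixes g :: "real^'d \<Rightarrow> real"
  assumes "g differentiable (at x)" and "\<And>y. g x \<le> g y"
  shows "gradient g x = 0"
proof -
  have "(g has_derivative (\<lambda>h. h \<bullet> gradient g x)) (at x)"
    using gradient_works[OF assms(1)] by (simp add: gderiv_def)
  then have "(\<lambda>h. h \<bullet> gradient g x) = (\<lambda>h. 0)"
    by (rule has_derivative_local_min) (simp add: assms(2))
  then show ?thesis
    by (metis inner_eq_zero_iff)
qed

lemma gradient_arg_min:
  fixes g :: "real^'d \<Rightarrow> real"
  assumes "strongly_convex \<mu> g" and "\<And>x. g differentiable (at x)" and "0 < \<mu>"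
  shows "gradient g (ARG_MIN g x. True) = 0"
proof (rule gradient_zero_at_min)
  obtain x where "\<And>y. g x \<le> g y"
    using strongly_convex_attains_min[OF assms] by blast
  then have "is_arg_min g (\<lambda>_. True) x"
    by (simp add: is_arg_min_linorder)
  then have "is_arg_min g (\<lambda>_. True) (ARG_MIN g x. True)"
    unfolding arg_min_def by (rule someI)
  then show "g (ARG_MIN g x. True) \<le> g y" for y
    by (simp add: is_arg_min_linorder)
qed (rule assms(2))

section \<open>Quadratic forms and extreme eigenvalues\<close>

lemma inner_matrix_vector_mult:
  fixes X :: "real^'n^'m"
  shows "x \<bullet> (X *v y) = (transpose X *v x) \<bullet> y"
  by (simp add: dot_lmul_matrix[symmetric])

lemma minus_matrix_vector_mult:
  fixes X :: "real^'n^'m"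
  shows "(- X) *v v = - (X *v v)"
  using matrix_vector_mult_diff_rdistrib[of 0 X v] by simp

text \<open>The polynomial \<open>t \<mapsto> (v + t w) \<bullet> X (v + t w)\<close> is nonnegative, so its discriminant is not
  positive. The degenerate case, where the leading coefficient is 0, matters as well: it shows that a null vector of the quadratic form lies in the kernel
  of \<open>X\<close>, which is how eigenvectors are found below.\<close>

lemma psd_Cauchy_Schwarz:
  fixes X :: "real^'n^'n"
  assumes sym: "transpose X = X" and psd: "\<And>v. 0 \<le> v \<bullet> (X *v v)"
  shows "(v \<bullet> (X *v w))\<^sup>2 \<le> (v \<bullet> (X *v v)) * (w \<bullet> (X *v w))"
proof -
  define a b c where "a = v \<bullet> (X *v v)" and "b = v \<bullet> (X *v w)" and "c = w \<bullet> (X *v w)"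
  have wv: "w \<bullet> (X *v v) = b"
    using inner_matrix_vector_mult[of w X v] sym by (simp add: b_def inner_commute)
  have quad: "0 \<le> a + 2 * t * b + t\<^sup>2 * c" for t
    using psd[of "v + t *\<^sub>R w"] wv
    by (simp add: matrix_vector_right_distrib matrix_vector_mult_scaleR inner_add_left
        inner_add_right a_def b_def c_def power2_eq_square algebra_simps)
  show ?thesis
  proof (cases "c = 0")
    case True
    have "b = 0"
    proof (rule ccontr)
      assume "b \<noteq> 0"
      then show False
        \<comment> \<open>The polynomial is linear with nonzero slope; here it has the value \<open>-1\<close>.\<close>
        using quad[of "- (a + 1) / (2 * b)"] True by (simp add: field_simps)
    qed
    then show ?thesis
      using True by (simp add: a_def b_def c_def)
  next
    case False
    then have "0 < c" using psd[of w] by (simp add: c_def)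
    then have "0 \<le> a - b\<^sup>2 / c"
      \<comment> \<open>the minimizer of the polynomial\<close>
      using quad[of "- b / c"] by (simp add: power2_eq_square field_simps)
    then show ?thesis
      using \<open>0 < c\<close> by (simp add: a_def b_def c_def field_simps)
  qed
qed

text \<open>The minimum \<open>l\<close> of the quadratic form on the unit sphere is an eigenvalue: \<open>X - l I\<close>
  is positive semidefinite and its form vanishes at a minimizer, which by the
  Cauchy-Schwarz inequality is therefore in its kernel.\<close>

lemma Rayleigh_min_eigenvalue:
  fixes X :: "real^'n^'n"
  assumes sym: "transpose X = X"
  obtains l where "l \<in> eigenvalues X" and "\<And>v. l * (norm v)\<^sup>2 \<le> v \<bullet> (X *v v)"
proof -
  obtain e :: "real^'n" where "norm e = 1"
    using vector_choose_size[of 1] by auto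
  then have "sphere (0::real^'n) 1 \<noteq> {}"
    by auto
  moreover have "continuous_on (sphere 0 1) (\<lambda>v. v \<bullet> (X *v v))"
    by (intro continuous_intros linear_continuous_on matrix_vector_mul_bounded_linear)
  ultimately obtain w where w: "norm w = 1"
    and min: "\<And>v. norm v = 1 \<Longrightarrow> w \<bullet> (X *v w) \<le> v \<bullet> (X *v v)"
    using continuous_attains_inf[of "sphere 0 1" "\<lambda>v. v \<bullet> (X *v v)"] by auto
  define l where "l = w \<bullet> (X *v w)"
  have bound: "l * (norm v)\<^sup>2 \<le> v \<bullet> (X *v v)" for v
  proof (cases "v = 0")
    case False
    have "l \<le> sgn v \<bullet> (X *v sgn v)"
      unfolding l_def using False by (intro min) (simp add: norm_sgn)
    also have "\<dots> = (v \<bullet> (X *v v)) / (norm v)\<^sup>2"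
      by (simp add: sgn_div_norm matrix_vector_mult_scaleR power2_eq_square field_simps)
    finally show ?thesis
      using False by (simp add: field_simps)
  qed simp
  define Q where "Q = X - l *\<^sub>R mat 1"
  have Qv: "Q *v v = X *v v - l *\<^sub>R v" for v
    by (simp add: Q_def matrix_vector_mult_diff_rdistrib scaleR_matrix_vector_assoc[symmetric])
  have "transpose Q = Q"
    using sym unfolding Q_def by (simp add: transpose_def vec_eq_iff mat_def eq_commute)
  moreover have "0 \<le> v \<bullet> (Q *v v)" for v
    using bound[of v] by (simp add: Qv inner_diff_right power2_norm_eq_inner)
  ultimately have "((Q *v w) \<bullet> (Q *v w))\<^sup>2 \<le> ((Q *v w) \<bullet> (Q *v (Q *v w))) * (w \<bullet> (Q *v w))"
    by (rule psd_Cauchy_Schwarz)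
  moreover have "w \<bullet> (Q *v w) = 0"
    using w by (simp add: Qv inner_diff_right l_def power2_norm_eq_inner[symmetric])
  ultimately have "Q *v w = 0"
    by simp
  then have "l \<in> eigenvalues X"
    using w by (auto simp: eigenvalues_def Qv intro!: exI[of _ w])
  then show ?thesis
    using bound that by blast
qed

lemma Rayleigh_max_eigenvalue:
  fixes X :: "real^'n^'n"
  assumes sym: "transpose X = X"
  obtains l where "l \<in> eigenvalues X" and "\<And>v. v \<bullet> (X *v v) \<le> l * (norm v)\<^sup>2"
proof -
  have "transpose (- X) = - X"
    using sym by (simp add: transpose_def vec_eq_iff)
  then obtain l where l: "l \<in> eigenvalues (- X)"
    and bound: "\<And>v. l * (norm v)\<^sup>2 \<le> v \<bullet> ((- X) *v v)"
    using Rayleigh_min_eigenvalue by blast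
  have "- l \<in> eigenvalues X"
    using l by (auto simp: eigenvalues_def minus_matrix_vector_mult minus_equation_iff[of "X *v _"])
  moreover have "v \<bullet> (X *v v) \<le> - l * (norm v)\<^sup>2" for v
    using bound[of v] by (simp add: minus_matrix_vector_mult)
  ultimately show ?thesis
    using that by blast
qed

text \<open>Eigenvectors of a symmetric matrix to distinct eigenvalues are orthogonal, hence
  linearly independent. Finiteness gives meaning to the \<open>Max\<close> and \<open>Min\<close> in \<open>lambda_max\<close> and
  \<open>lambda_min\<close>.\<close>

lemma finite_eigenvalues:
  fixes X :: "real^'n^'n"
  assumes sym: "transpose X = X"
  shows "finite (eigenvalues X)"
proof -
  have "\<forall>l\<in>eigenvalues X. \<exists>v. v \<noteq> 0 \<and> X *v v = l *\<^sub>R v"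
    by (simp add: eigenvalues_def)
  then obtain w where w: "\<And>l. l \<in> eigenvalues X \<Longrightarrow> w l \<noteq> 0 \<and> X *v w l = l *\<^sub>R w l"
    by metis
  have orth: "w k \<bullet> w l = 0" if "k \<in> eigenvalues X" "l \<in> eigenvalues X" "k \<noteq> l" for k l
  proof -
    have "l * (w k \<bullet> w l) = w k \<bullet> (X *v w l)"
      using w that by simp
    also have "\<dots> = k * (w k \<bullet> w l)"
      using w that inner_matrix_vector_mult[of "w k" X "w l"] sym by simp
    finally show ?thesis using that by simp
  qed
  have inj: "inj_on w (eigenvalues X)"
    by (metis inj_onI inner_eq_zero_iff orth w)
  have "pairwise orthogonal (w ` eigenvalues X)"
    by (auto simp: pairwise_def orthogonal_def intro!: orth)
  then have "independent (w ` eigenvalues X)"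
    using w by (intro pairwise_orthogonal_independent) auto
  then show ?thesis
    using inj independent_imp_finite finite_image_iff by blast
qed

lemma lambda_min_le_quadratic_form:
  fixes X :: "real^'n^'n"
  assumes "transpose X = X"
  shows "lambda_min X * (norm v)\<^sup>2 \<le> v \<bullet> (X *v v)"
proof -
  obtain l where l: "l \<in> eigenvalues X" "l * (norm v)\<^sup>2 \<le> v \<bullet> (X *v v)"
    using Rayleigh_min_eigenvalue[OF assms] by metis
  then have "lambda_min X \<le> l"
    unfolding lambda_min_def using finite_eigenvalues[OF assms] by (intro Min_le)
  then show ?thesis
    using l(2) by (meson mult_right_mono order_trans zero_le_power2)
qed

lemma quadratic_form_le_lambda_max:
  fixes X :: "real^'n^'n"
  assumes "transpose X = X"
  shows "v \<bullet> (X *v v) \<le> lambda_max X * (norm v)\<^sup>2"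
proof -
  obtain l where l: "l \<in> eigenvalues X" "v \<bullet> (X *v v) \<le> l * (norm v)\<^sup>2"
    using Rayleigh_max_eigenvalue[OF assms] by metis
  then have "l \<le> lambda_max X"
    unfolding lambda_max_def using finite_eigenvalues[OF assms] by (intro Max_ge)
  then show ?thesis
    using l(2) by (meson mult_right_mono order_trans zero_le_power2)
qed

text \<open>Every eigenvalue of \<open>P \<theta>\<close> is a value of the continuous function
  \<open>(\<theta>, v) \<mapsto> v \<bullet> (P \<theta> *v v)\<close> on the compact product of \<open>\<Theta>\<close> with the unit sphere. Working with
  this joint function avoids any continuity statement about the extreme eigenvalues themselves.\<close>

lemma eigenvalues_bounded_on_compact:
  fixes P :: "'a::topological_space \<Rightarrow> real^'n^'n"
  assumes "compact \<Theta>" and "\<Theta> \<noteq> {}" and cont: "continuous_on \<Theta> P"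
    and pos: "\<And>\<theta>. \<theta> \<in> \<Theta> \<Longrightarrow> pos_def (P \<theta>)"
  obtains \<delta> K where "0 < \<delta>" and "\<And>\<theta>. \<theta> \<in> \<Theta> \<Longrightarrow> eigenvalues (P \<theta>) \<subseteq> {\<delta>..K}"
proof -
  define S :: "('a \<times> (real^'n)) set" where "S = \<Theta> \<times> sphere 0 1"
  define F where "F = (\<lambda>(\<theta>, v). v \<bullet> (P \<theta> *v v))"
  obtain e :: "real^'n" where "norm e = 1"
    using vector_choose_size[of 1] by auto
  then have "sphere (0::real^'n) 1 \<noteq> {}"
    by auto
  then have S: "compact S" "S \<noteq> {}"
    using assms(1,2) by (auto simp: S_def intro!: compact_Times)
  have "continuous_on S (\<lambda>z. P (fst z))"
    using cont by (rule continuous_on_compose2) (auto simp: S_def intro!: continuous_intros)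
  then have F: "continuous_on S F"
    unfolding F_def case_prod_beta inner_vec_def matrix_vector_mult_def
    by (simp, intro continuous_intros)
  obtain z where z: "z \<in> S" "\<And>x. x \<in> S \<Longrightarrow> F z \<le> F x"
    using continuous_attains_inf[OF S F] by blast
  obtain z' where z': "z' \<in> S" "\<And>x. x \<in> S \<Longrightarrow> F x \<le> F z'"
    using continuous_attains_sup[OF S F] by blast
  have "0 < F z"
  proof -
    obtain \<theta> v where v: "z = (\<theta>, v)" "\<theta> \<in> \<Theta>" "norm v = 1"
      using z(1) by (auto simp: S_def)
    then have "v \<noteq> 0" by auto
    then show ?thesis
      using v pos[of \<theta>] by (simp add: F_def pos_def_def)
  qed
  moreover have "eigenvalues (P \<theta>) \<subseteq> {F z..F z'}" if "\<theta> \<in> \<Theta>" for \<theta>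
  proof
    fix l assume "l \<in> eigenvalues (P \<theta>)"
    then obtain v where v: "v \<noteq> 0" "P \<theta> *v v = l *\<^sub>R v"
      by (auto simp: eigenvalues_def)
    have "P \<theta> *v sgn v = l *\<^sub>R sgn v"
      using v by (simp add: sgn_div_norm matrix_vector_mult_scaleR)
    then have "F (\<theta>, sgn v) = l"
      using v by (simp add: F_def power2_norm_eq_inner[symmetric] norm_sgn)
    moreover have "(\<theta>, sgn v) \<in> S"
      using v that by (simp add: S_def norm_sgn)
    ultimately show "l \<in> {F z..F z'}"
      using z(2) z'(2) by fastforce
  qed
  ultimately show ?thesis
    using that by blast
qed

text \<open>The eigenvalue bounds make the infimum and the supremum range over bounded sets, so that
  they compare correctly with the extreme eigenvalues at each single \<open>\<theta>\<close>.\<close>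

lemma uniform_quadratic_form_bounds:
  fixes P :: "'a::topological_space \<Rightarrow> real^'n^'n"
  assumes "compact \<Theta>" and "\<Theta> \<noteq> {}" and "continuous_on \<Theta> P"
    and pos: "\<And>\<theta>. \<theta> \<in> \<Theta> \<Longrightarrow> pos_def (P \<theta>)"
  shows "0 < (INF \<theta>\<in>\<Theta>. lambda_min (P \<theta>))"
    and "\<And>\<theta> v. \<theta> \<in> \<Theta> \<Longrightarrow> (INF \<theta>\<in>\<Theta>. lambda_min (P \<theta>)) * (norm v)\<^sup>2 \<le> v \<bullet> (P \<theta> *v v)"
    and "\<And>\<theta> v. \<theta> \<in> \<Theta> \<Longrightarrow> v \<bullet> (P \<theta> *v v) \<le> (SUP \<theta>\<in>\<Theta>. lambda_max (P \<theta>)) * (norm v)\<^sup>2"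
proof -
  obtain \<delta> K where "0 < \<delta>" and ev: "\<And>\<theta>. \<theta> \<in> \<Theta> \<Longrightarrow> eigenvalues (P \<theta>) \<subseteq> {\<delta>..K}"
    using eigenvalues_bounded_on_compact[OF assms] by blast
  have sym: "transpose (P \<theta>) = P \<theta>" if "\<theta> \<in> \<Theta>" for \<theta>
    using pos[OF that] by (simp add: pos_def_def)
  have fin: "finite (eigenvalues (P \<theta>))" and ne: "eigenvalues (P \<theta>) \<noteq> {}" if "\<theta> \<in> \<Theta>" for \<theta>
    using finite_eigenvalues[OF sym[OF that]] Rayleigh_min_eigenvalue[OF sym[OF that]] by blast+
  have lo: "\<delta> \<le> lambda_min (P \<theta>)" and up: "lambda_max (P \<theta>) \<le> K" if "\<theta> \<in> \<Theta>" for \<theta>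
    using Min_in[OF fin ne, OF that that] Max_in[OF fin ne, OF that that] ev[OF that]
    unfolding lambda_min_def lambda_max_def by auto
  have bdd: "bdd_below ((\<lambda>\<theta>. lambda_min (P \<theta>)) ` \<Theta>)" "bdd_above ((\<lambda>\<theta>. lambda_max (P \<theta>)) ` \<Theta>)"
    using lo up by (auto intro!: bdd_belowI2 bdd_aboveI2)
  have "\<delta> \<le> (INF \<theta>\<in>\<Theta>. lambda_min (P \<theta>))"
    using assms(2) lo by (rule cINF_greatest)
  then show "0 < (INF \<theta>\<in>\<Theta>. lambda_min (P \<theta>))"
    using \<open>0 < \<delta>\<close> by simp
  fix \<theta> :: 'a and v :: "real^'n" assume \<theta>: "\<theta> \<in> \<Theta>"
  show "(INF \<theta>\<in>\<Theta>. lambda_min (P \<theta>)) * (norm v)\<^sup>2 \<le> v \<bullet> (P \<theta> *v v)"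
    by (rule order_trans[OF mult_right_mono[OF cINF_lower[OF bdd(1) \<theta>]]
          lambda_min_le_quadratic_form[OF sym[OF \<theta>]]]) simp
  show "v \<bullet> (P \<theta> *v v) \<le> (SUP \<theta>\<in>\<Theta>. lambda_max (P \<theta>)) * (norm v)\<^sup>2"
    by (rule order_trans[OF quadratic_form_le_lambda_max[OF sym[OF \<theta>]]
          mult_right_mono[OF cSUP_upper[OF \<theta> bdd(2)]]]) simp
qed

section \<open>The norm of a positive definite matrix\<close>

definition weighted_norm :: "real^'n^'n \<Rightarrow> real^'n \<Rightarrow> real"
  where "weighted_norm X v = sqrt (v \<bullet> (X *v v))"

lemma pos_def_nonneg:
  fixes X :: "real^'n^'n"
  shows "pos_def X \<Longrightarrow> 0 \<le> v \<bullet> (X *v v)"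
  by (cases "v = 0") (auto simp: pos_def_def less_imp_le)

lemma weighted_norm_triangle:
  fixes X :: "real^'n^'n"
  assumes "pos_def X"
  shows "weighted_norm X (v + w) \<le> weighted_norm X v + weighted_norm X w"
proof -
  have sym: "transpose X = X"
    using assms by (simp add: pos_def_def)
  have psd: "0 \<le> x \<bullet> (X *v x)" for x
    by (rule pos_def_nonneg[OF assms])
  have "v \<bullet> (X *v w) \<le> \<bar>v \<bullet> (X *v w)\<bar>" by simp
  also have "\<dots> \<le> weighted_norm X v * weighted_norm X w"
    using real_sqrt_le_mono[OF psd_Cauchy_Schwarz[OF sym psd, of v w]]
    by (simp add: weighted_norm_def real_sqrt_mult)
  finally have cs: "v \<bullet> (X *v w) \<le> weighted_norm X v * weighted_norm X w" .
  have "w \<bullet> (X *v v) = v \<bullet> (X *v w)"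
    using inner_matrix_vector_mult[of w X v] sym by (simp add: inner_commute)
  then have "(v + w) \<bullet> (X *v (v + w)) = v \<bullet> (X *v v) + 2 * (v \<bullet> (X *v w)) + w \<bullet> (X *v w)"
    by (simp add: matrix_vector_right_distrib inner_add_left inner_add_right)
  also have "\<dots> \<le> (weighted_norm X v + weighted_norm X w)\<^sup>2"
    using cs psd by (simp add: power2_sum weighted_norm_def)
  finally show ?thesis
    using psd by (simp add: weighted_norm_def real_le_lsqrt)
qed

section \<open>Evaluating the matrix inequality blockwise\<close>

text \<open>The vector counterpart of \<open>vcat\<close>.\<close>

definition join :: "real^'a \<Rightarrow> real^'b \<Rightarrow> real^('a + 'b)"
  where "join x y = (\<chi> i. case i of Inl a \<Rightarrow> x $ a | Inr b \<Rightarrow> y $ b)"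

lemma sum_UNIV_Plus:
  fixes h :: "'a::finite + 'b::finite \<Rightarrow> 'c::comm_monoid_add"
  shows "(\<Sum>i\<in>UNIV. h i) = (\<Sum>a\<in>UNIV. h (Inl a)) + (\<Sum>b\<in>UNIV. h (Inr b))"
  by (simp add: UNIV_Plus_UNIV[symmetric] sum.Plus del: UNIV_Plus_UNIV)

lemma inner_join: "join x y \<bullet> join x' y' = x \<bullet> x' + y \<bullet> y'"
  by (simp add: inner_vec_def join_def sum_UNIV_Plus)

lemma join_add: "join x y + join x' y' = join (x + x') (y + y')"
  by (simp add: join_def vec_eq_iff split: sum.split)

lemma hcat_join: "hcat X Y *v join x y = X *v x + Y *v y"
  by (simp add: hcat_def join_def matrix_vector_mult_def vec_eq_iff sum_UNIV_Plus)

lemma vcat_mult: "vcat X Y *v x = join (X *v x) (Y *v x)"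
  by (simp add: vcat_def join_def matrix_vector_mult_def vec_eq_iff split: sum.split)

lemma block_diag_join: "block_diag X Y *v join x y = join (X *v x) (Y *v y)"
  by (simp add: block_diag_def vcat_mult hcat_join)

lemma sum_UNIV_prod:
  fixes h :: "'a::finite \<times> 'b::finite \<Rightarrow> 'c::comm_monoid_add"
  shows "(\<Sum>r\<in>UNIV. h r) = (\<Sum>a\<in>UNIV. \<Sum>b\<in>UNIV. h (a, b))"
  by (simp add: UNIV_Times_UNIV[symmetric] sum.cartesian_product del: UNIV_Times_UNIV)

lemma inner_eq_sum_block:
  fixes w w' :: "real^('p::finite \<times> 'd::finite)"
  shows "w \<bullet> w' = (\<Sum>i\<in>UNIV. block w i \<bullet> block w' i)"
  by (simp add: inner_vec_def block_def sum_UNIV_prod)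

lemma block_add: "block (v + w) i = block v i + block w i"
  and block_diff: "block (v - w) i = block v i - block w i"
  and block_stack: "block (stack h) i = h i"
  by (simp_all add: block_def stack_def vec_eq_iff)

lemma block_kron_diag:
  fixes w :: "real^('p::finite \<times> 'd::finite)"
  shows "block (kron (diag_mat l) X *v w) i = l $ i *\<^sub>R (X *v block w i)"
proof -
  have "(\<Sum>a\<in>UNIV. \<Sum>b\<in>UNIV. (if i = a then l $ i else 0) * X $ j $ b * w $ (a, b))
      = (\<Sum>b\<in>UNIV. l $ i * X $ j $ b * w $ (i, b))" for j
  proof -
    have "(\<Sum>a\<in>UNIV. \<Sum>b\<in>UNIV. (if i = a then l $ i else 0) * X $ j $ b * w $ (a, b))
        = (\<Sum>a\<in>UNIV. if i = a then (\<Sum>b\<in>UNIV. l $ i * X $ j $ b * w $ (a, b)) else 0)"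
      by (intro sum.cong) auto
    then show ?thesis by simp
  qed
  then show ?thesis
    by (simp add: block_def kron_def diag_mat_def matrix_vector_mult_def vec_eq_iff
        sum_UNIV_prod sum_distrib_left mult.assoc cong: if_cong)
qed

lemma block_kron_id:
  fixes w :: "real^('p::finite \<times> 'd::finite)"
  shows "block (kron (mat 1) X *v w) i = X *v block w i"
proof -
  have "mat 1 = diag_mat (vec 1 :: real^'p)"
    by (simp add: mat_def diag_mat_def vec_eq_iff)
  then show ?thesis
    by (simp add: block_kron_diag)
qed

lemma block_kron_col_ones:
  fixes x :: "real^'d"
  shows "block (kron_col (vec 1) (mat 1) *v x) i = x"
proof -
  have "block (kron_col (vec 1) (mat 1) *v x) i = mat 1 *v x"
    by (simp add: block_def kron_col_def matrix_vector_mult_def)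
  then show ?thesis by simp
qed

lemma lmi_quadratic_form:
  fixes A :: "real^'n^'n" and B :: "real^'q^'n" and C :: "real^'n^'r" and D :: "real^'q^'r"
    and P Q :: "real^'n^'n" and N :: "real^'r^'r" and e :: "real^'n" and u :: "real^'q"
  defines "G \<equiv> vcat (hcat (mat 1) 0) (vcat (hcat A B) (hcat C D))"
  shows "join e u \<bullet> ((transpose G ** block_diag P (block_diag Q N) ** G) *v join e u)
    = e \<bullet> (P *v e) + (A *v e + B *v u) \<bullet> (Q *v (A *v e + B *v u))
      + (C *v e + D *v u) \<bullet> (N *v (C *v e + D *v u))"
proof -
  have G: "G *v join e u = join e (join (A *v e + B *v u) (C *v e + D *v u))"
    by (simp add: G_def vcat_mult hcat_join)
  have "join e u \<bullet> ((transpose G ** block_diag P (block_diag Q N) ** G) *v join e u)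
      = (G *v join e u) \<bullet> (block_diag P (block_diag Q N) *v (G *v join e u))"
    using inner_matrix_vector_mult[of "join e u" "transpose G"]
    by (simp add: matrix_vector_mul_assoc[symmetric])
  then show ?thesis
    by (simp add: G block_diag_join inner_join)
qed

text \<open>The exchange matrix pairs the two halves of each block of \<open>w\<close>, which are
  \<open>a dy\<^sub>i - u\<^sub>i\<close> and \<open>u\<^sub>i - b dy\<^sub>i\<close>. So the form is a weighted sum of exactly the products
  that \<open>gradient_sector\<close> bounds, and the symmetry of the exchange matrix yields the factor 2.\<close>

lemma multiplier_quadratic_form:
  fixes l :: "real^'p" and dy u :: "real^('p::finite \<times> 'd::finite)" and a b :: real
  defines "w \<equiv> kron (mat 1) (vcat (a *\<^sub>R mat 1) (- b *\<^sub>R mat 1)) *v dy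
      + kron (mat 1) (vcat (- mat 1) (mat 1)) *v u"
  shows "w \<bullet> (kron (diag_mat l) (vcat (hcat 0 (mat 1)) (hcat (mat 1) 0)) *v w)
    = 2 * (\<Sum>i\<in>UNIV. l $ i *
        ((a *\<^sub>R block dy i - block u i) \<bullet> (block u i - b *\<^sub>R block dy i)))"
proof -
  have w: "block w i = join (a *\<^sub>R block dy i - block u i) (block u i - b *\<^sub>R block dy i)" for i
    by (simp add: w_def block_add block_kron_id vcat_mult join_add minus_matrix_vector_mult
        scaleR_matrix_vector_assoc[symmetric])
  show ?thesis
    unfolding inner_eq_sum_block block_kron_diag w vcat_mult hcat_join
    by (simp add: inner_join inner_commute sum_distrib_left algebra_simps)
qed

section \<open>Tracking bound\<close>

lemma linear_recursion_bound:
  fixes a d :: "nat \<Rightarrow> real"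
  assumes "0 \<le> \<rho>" and step: "\<And>k. a (Suc k) \<le> \<rho> * a k + d k"
  shows "a k \<le> \<rho> ^ k * a 0 + (\<Sum>t=1..k. \<rho> ^ (k - t) * d (t - 1))"
proof (induction k)
  case (Suc k)
  have "(\<Sum>t=1..k. \<rho> ^ (Suc k - t) * d (t - 1)) = \<rho> * (\<Sum>t=1..k. \<rho> ^ (k - t) * d (t - 1))"
    by (auto simp: sum_distrib_left Suc_diff_le intro!: sum.cong)
  moreover have "a (Suc k) \<le> \<rho> * (\<rho> ^ k * a 0 + (\<Sum>t=1..k. \<rho> ^ (k - t) * d (t - 1))) + d k"
    using step[of k] mult_left_mono[OF Suc.IH \<open>0 \<le> \<rho>\<close>] by linarith
  ultimately show ?case
    by (simp add: algebra_simps)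
qed simp

theorem theorem5p1:
  fixes \<Theta> :: "(real^'t) set"
    and m L :: "real^'t \<Rightarrow> real"
    and f :: "real^'d \<Rightarrow> real^'t \<Rightarrow> real"
    and \<nu>_low \<nu>_up :: "real^'t"
    and Ab :: "real^'t \<Rightarrow> real^'n^'n"
    and Bb :: "real^'t \<Rightarrow> real^'d^'n"
    and Cb :: "real^'t \<Rightarrow> real^'n^'d"
    and Cx :: "real^'n^'d"
    and U :: "real^'d^'n"
    and A :: "real^'t \<Rightarrow> real^'n^'n"
    and B :: "real^'t \<Rightarrow> real^('p::{finite,linorder} \<times> 'd)^'n"
    and C :: "real^'t \<Rightarrow> real^'n^('p \<times> 'd)"
    and D :: "real^'t \<Rightarrow> real^('p \<times> 'd)^('p \<times> 'd)"
    and D\<Psi>y D\<Psi>u :: "real^'t \<Rightarrow> real^('p \<times> 'd)^('p \<times> ('d + 'd))"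
    and Chat :: "real^'t \<Rightarrow> real^'n^('p \<times> ('d + 'd))"
    and Dhat :: "real^'t \<Rightarrow> real^('p \<times> 'd)^('p \<times> ('d + 'd))"
    and M :: "real^('d + 'd)^('d + 'd)"
    and Mlam :: "real^'t \<Rightarrow> real^('p \<times> ('d + 'd))^('p \<times> ('d + 'd))"
    and G :: "real^'t \<Rightarrow> real^('n + 'p \<times> 'd)^('n + ('n + 'p \<times> ('d + 'd)))"
    and P :: "real^'t \<Rightarrow> real^'n^'n"
    and lamp :: "real^'t \<Rightarrow> real^'p::{finite,linorder}"
    and \<rho> c lam_up lam_low :: real
    and \<theta> :: "nat \<Rightarrow> real^'t"
    and xstar :: "nat \<Rightarrow> real^'d"
    and \<xi> \<xi>star \<Delta>\<xi>star :: "nat \<Rightarrow> real^'n"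
    and y u :: "nat \<Rightarrow> real^('p \<times> 'd)"
  defines "A \<equiv> \<lambda>\<theta>. mat_pow (Ab \<theta>) CARD('p)"
    and "B \<equiv> \<lambda>\<theta>. lift_B (Ab \<theta>) (Bb \<theta>)"
    and "C \<equiv> \<lambda>\<theta>. lift_C (Ab \<theta>) (Cb \<theta>)"
    and "D \<equiv> \<lambda>\<theta>. lift_D (Ab \<theta>) (Bb \<theta>) (Cb \<theta>)"
    and "D\<Psi>y \<equiv> \<lambda>\<theta>. kron (mat 1) (vcat (L \<theta> *\<^sub>R mat 1) (- m \<theta> *\<^sub>R mat 1))"
    and "D\<Psi>u \<equiv> \<lambda>\<theta>. kron (mat 1) (vcat (- mat 1) (mat 1))"
    and "Chat \<equiv> \<lambda>\<theta>. D\<Psi>y \<theta> ** C \<theta>"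
    and "Dhat \<equiv> \<lambda>\<theta>. D\<Psi>y \<theta> ** D \<theta> + D\<Psi>u \<theta>"
    and "M \<equiv> vcat (hcat 0 (mat 1)) (hcat (mat 1) 0)"
    and "Mlam \<equiv> \<lambda>\<theta>. kron (diag_mat (lamp \<theta>)) M"
    and "G \<equiv> \<lambda>\<theta>. vcat (hcat (mat 1) 0) (vcat (hcat (A \<theta>) (B \<theta>)) (hcat (Chat \<theta>) (Dhat \<theta>)))"
    and "xstar \<equiv> \<lambda>k. (ARG_MIN (\<lambda>x. f x (\<theta> k)) x. True)"
    and "\<xi>star \<equiv> \<lambda>k. U *v xstar k"
    and "\<Delta>\<xi>star \<equiv> \<lambda>k. \<xi>star k - \<xi>star (Suc k)"
    and "lam_up \<equiv> (SUP \<theta>\<in>\<Theta>. lambda_max (P \<theta>))"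
    and "lam_low \<equiv> (INF \<theta>\<in>\<Theta>. lambda_min (P \<theta>))"
    and "c \<equiv> sqrt (lam_up / lam_low)"
  assumes compact: "compact \<Theta>"
    and f: "class_S \<Theta> m L f"
    and cont_Ab: "continuous_on \<Theta> Ab"
    and cont_Bb: "continuous_on \<Theta> Bb"
    and cont_Cb: "continuous_on \<Theta> Cb"
    and \<theta>_in: "\<And>k. \<theta> k \<in> \<Theta>"
    and \<theta>_rate: "\<And>k. \<nu>_low \<le> \<theta> (Suc k) - \<theta> k \<and> \<theta> (Suc k) - \<theta> k \<le> \<nu>_up"
    and \<xi>_step: "\<And>k. \<xi> (Suc k) = A (\<theta> k) *v \<xi> k + B (\<theta> k) *v u k"
    and y_out: "\<And>k. y k = C (\<theta> k) *v \<xi> k + D (\<theta> k) *v u k"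
    and u_grad: "\<And>k. u k = stack (\<lambda>i. gradient (\<lambda>x. f x (\<theta> k)) (block (y k) i))"
    and U_A: "\<And>\<theta>. \<theta> \<in> \<Theta> \<Longrightarrow> (mat 1 - A \<theta>) ** U = 0"
    and U_C: "\<And>\<theta>. \<theta> \<in> \<Theta> \<Longrightarrow> C \<theta> ** U = kron_col (vec 1) (mat 1)"
    and U_Cx: "Cx ** U = mat 1"
    and cont_P: "continuous_on \<Theta> P"
    and pos_P: "\<And>\<theta>. \<theta> \<in> \<Theta> \<Longrightarrow> pos_def (P \<theta>)"
    and cont_lamp: "continuous_on \<Theta> lamp"
    and nonneg_lamp: "\<And>\<theta>. \<theta> \<in> \<Theta> \<Longrightarrow> 0 \<le> lamp \<theta>"
    and \<rho>: "0 < \<rho>" "\<rho> < 1"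
    and LMI: "\<And>\<theta> \<Delta>\<theta>. (\<theta>, \<Delta>\<theta>) \<in> admissible_variations \<Theta> \<nu>_low \<nu>_up \<Longrightarrow>
      neg_semidef (transpose (G \<theta>)
        ** block_diag (- \<rho>\<^sup>2 *\<^sub>R P \<theta>) (block_diag (P (\<theta> + \<Delta>\<theta>)) (Mlam \<theta>))
        ** G \<theta>)"
  shows "norm (\<xi> k - \<xi>star k)
    \<le> c * \<rho> ^ k * norm (\<xi> 0 - \<xi>star 0)
      + c * (\<Sum>t=1..k. \<rho> ^ (k - t) * norm (\<Delta>\<xi>star (t - 1)))"
proof -
  define V where "V j = weighted_norm (P (\<theta> j))" for j
  have \<Theta>_ne: "\<Theta> \<noteq> {}"
    using \<theta>_in by blast
  have bounds: "0 < lam_low"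
    "\<And>\<theta> v. \<theta> \<in> \<Theta> \<Longrightarrow> lam_low * (norm v)\<^sup>2 \<le> v \<bullet> (P \<theta> *v v)"
    "\<And>\<theta> v. \<theta> \<in> \<Theta> \<Longrightarrow> v \<bullet> (P \<theta> *v v) \<le> lam_up * (norm v)\<^sup>2"
    unfolding lam_low_def lam_up_def
    using uniform_quadratic_form_bounds[OF compact \<Theta>_ne cont_P] pos_P by blast+
  have V_lower: "sqrt lam_low * norm v \<le> V j v" and V_upper: "V j v \<le> sqrt lam_up * norm v" for j v
    using real_sqrt_le_mono[OF bounds(2)[OF \<theta>_in, of v j]]
      real_sqrt_le_mono[OF bounds(3)[OF \<theta>_in, of v j]]
    by (simp_all add: V_def weighted_norm_def real_sqrt_mult)

  \<comment> \<open>The next state is compared with the minimizer of the current function, since this is the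
    fixed point of the step from \<open>j\<close> to \<open>Suc j\<close>; the norm is already the next one.\<close>
  have contraction: "V (Suc j) (\<xi> (Suc j) - \<xi>star j) \<le> \<rho> * V j (\<xi> j - \<xi>star j)" for j
  proof -
    let ?\<theta> = "\<theta> j" and ?g = "\<lambda>x. f x (\<theta> j)"
    define e where "e = \<xi> j - \<xi>star j"
    define dy where "dy = C ?\<theta> *v e + D ?\<theta> *v u j"
    have mL: "0 < m ?\<theta>" "m ?\<theta> < L ?\<theta>"
      and sc: "strongly_convex (m ?\<theta>) ?g" and sm: "smooth_with (L ?\<theta>) ?g"
      using f \<theta>_in[of j] unfolding class_S_def by (auto intro: less_trans)
    have "\<And>x. ?g differentiable (at x)"
      using sm by (simp add: smooth_with_def)
    then have stationary: "gradient ?g (xstar j) = 0"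
      unfolding xstar_def using gradient_arg_min[OF sc _ mL(1)] by blast
    have "C ?\<theta> *v \<xi>star j = kron_col (vec 1) (mat 1) *v xstar j"
      by (simp add: \<xi>star_def matrix_vector_mul_assoc U_C[OF \<theta>_in] del: vec_1)
    then have "block (C ?\<theta> *v \<xi>star j) i = xstar j" for i
      by (metis block_kron_col_ones)
    moreover have "dy = y j - C ?\<theta> *v \<xi>star j"
      by (simp add: dy_def e_def y_out matrix_vector_mult_diff_distrib)
    ultimately have dy: "block dy i = block (y j) i - xstar j" for i
      by (simp add: block_diff)
    have "A ?\<theta> *v \<xi>star j = \<xi>star j"
    proof -
      have "(mat 1 - A ?\<theta>) *v (U *v xstar j) = 0"
        by (simp add: matrix_vector_mul_assoc U_A[OF \<theta>_in])
      then show ?thesis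
        by (simp add: \<xi>star_def matrix_vector_mult_diff_rdistrib)
    qed
    then have next_error: "A ?\<theta> *v e + B ?\<theta> *v u j = \<xi> (Suc j) - \<xi>star j"
      by (simp add: e_def \<xi>_step matrix_vector_mult_diff_distrib)
    have hat: "Chat ?\<theta> *v e + Dhat ?\<theta> *v u j = D\<Psi>y ?\<theta> *v dy + D\<Psi>u ?\<theta> *v u j"
      by (simp add: Chat_def Dhat_def dy_def matrix_vector_mul_assoc[symmetric]
          matrix_vector_right_distrib matrix_vector_mult_add_rdistrib)
    have multiplier: "0 \<le> (D\<Psi>y ?\<theta> *v dy + D\<Psi>u ?\<theta> *v u j)
        \<bullet> (Mlam ?\<theta> *v (D\<Psi>y ?\<theta> *v dy + D\<Psi>u ?\<theta> *v u j))"
      unfolding D\<Psi>y_def D\<Psi>u_def Mlam_def M_def multiplier_quadratic_form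
    proof (intro mult_nonneg_nonneg sum_nonneg)
      fix i
      show "0 \<le> lamp ?\<theta> $ i"
        using nonneg_lamp[OF \<theta>_in[of j]] by (simp add: less_eq_vec_def)
      show "0 \<le> (L ?\<theta> *\<^sub>R block dy i - block (u j) i) \<bullet> (block (u j) i - m ?\<theta> *\<^sub>R block dy i)"
        using gradient_sector[OF sc sm mL(2), of "block (y j) i" "xstar j"]
        by (simp add: dy u_grad[of j] block_stack stationary)
    qed simp
    have "(?\<theta>, \<theta> (Suc j) - ?\<theta>) \<in> admissible_variations \<Theta> \<nu>_low \<nu>_up"
      using \<theta>_in \<theta>_rate by (simp add: admissible_variations_def)
    from LMI[OF this] have "join e (u j) \<bullet> ((transpose (G ?\<theta>)
        ** block_diag (- \<rho>\<^sup>2 *\<^sub>R P ?\<theta>) (block_diag (P (\<theta> (Suc j))) (Mlam ?\<theta>))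
        ** G ?\<theta>) *v join e (u j)) \<le> 0"
      by (simp add: neg_semidef_def)
    then have "(\<xi> (Suc j) - \<xi>star j) \<bullet> (P (\<theta> (Suc j)) *v (\<xi> (Suc j) - \<xi>star j))
        \<le> \<rho>\<^sup>2 * (e \<bullet> (P ?\<theta> *v e))"
      unfolding G_def lmi_quadratic_form next_error hat
      using multiplier by (simp add: minus_matrix_vector_mult scaleR_matrix_vector_assoc[symmetric])
    then have "V (Suc j) (\<xi> (Suc j) - \<xi>star j) \<le> sqrt (\<rho>\<^sup>2 * (e \<bullet> (P ?\<theta> *v e)))"
      by (simp add: V_def weighted_norm_def)
    also have "\<dots> = \<rho> * V j (\<xi> j - \<xi>star j)"
      using \<rho> by (simp add: real_sqrt_mult V_def weighted_norm_def e_def)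
    finally show ?thesis .
  qed

  have "V (Suc j) (\<xi> (Suc j) - \<xi>star (Suc j))
      \<le> \<rho> * V j (\<xi> j - \<xi>star j) + sqrt lam_up * norm (\<Delta>\<xi>star j)" for j
  proof -
    have "\<xi> (Suc j) - \<xi>star (Suc j) = (\<xi> (Suc j) - \<xi>star j) + \<Delta>\<xi>star j"
      by (simp add: \<Delta>\<xi>star_def)
    then have "V (Suc j) (\<xi> (Suc j) - \<xi>star (Suc j))
        \<le> V (Suc j) (\<xi> (Suc j) - \<xi>star j) + V (Suc j) (\<Delta>\<xi>star j)"
      unfolding V_def using weighted_norm_triangle[OF pos_P[OF \<theta>_in]] by metis
    then show ?thesis
      using contraction[of j] V_upper[of "Suc j" "\<Delta>\<xi>star j"] by linarith
  qed
  from linear_recursion_bound[OF less_imp_le[OF \<rho>(1)], of "\<lambda>j. V j (\<xi> j - \<xi>star j)", OF this, of k]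
  have "V k (\<xi> k - \<xi>star k) \<le> \<rho> ^ k * V 0 (\<xi> 0 - \<xi>star 0)
      + (\<Sum>t=1..k. \<rho> ^ (k - t) * (sqrt lam_up * norm (\<Delta>\<xi>star (t - 1))))" .
  moreover have "\<rho> ^ k * V 0 (\<xi> 0 - \<xi>star 0) \<le> \<rho> ^ k * (sqrt lam_up * norm (\<xi> 0 - \<xi>star 0))"
    using V_upper \<rho> by (intro mult_left_mono) auto
  ultimately have "sqrt lam_low * norm (\<xi> k - \<xi>star k)
      \<le> sqrt lam_up * (\<rho> ^ k * norm (\<xi> 0 - \<xi>star 0)
        + (\<Sum>t=1..k. \<rho> ^ (k - t) * norm (\<Delta>\<xi>star (t - 1))))"
    using V_lower[of "\<xi> k - \<xi>star k" k] by (simp add: sum_distrib_left algebra_simps)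
  then have "norm (\<xi> k - \<xi>star k)
      \<le> sqrt lam_up * (\<rho> ^ k * norm (\<xi> 0 - \<xi>star 0)
        + (\<Sum>t=1..k. \<rho> ^ (k - t) * norm (\<Delta>\<xi>star (t - 1)))) / sqrt lam_low"
    using bounds(1) by (simp add: pos_le_divide_eq mult.commute)
  then show ?thesis
    by (simp add: c_def real_sqrt_divide algebra_simps add_divide_distrib)
qed

end
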